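(* Let $m$ be a non-negative integer. For $z\in\mathbb{C}$ with $|z|<1$, $$T_m^3(1-2z)=F^3\left(-m,m;\tfrac12;z\right)=\sum_{n=0}^\infty v_n z^n,$$ where $v_0=1$, $v_1=-6m^2$, $v_2=2(7m^4-m^2)$ and, with the convention $v_{-1}=0$, for all $n\ge1$, $$\begin{aligned}v_{n+1}={}&\frac{-20m^2+6n^2-9n+5}{2n^2+3n+1}v_n\\&+\frac{-36m^4+20m^2(n-1)(4n-5)-2(n-1)(2n(3(n-4)n+17)-17)}{n(n+1)(2n-1)(2n+1)}v_{n-1}\\&+\frac{4\left(9m^4-10m^2(n-2)^2+(n-2)^4\right)}{n(n+1)(2n-1)(2n+1)}v_{n-2}.\end{aligned}$$
   Context: $T_m$ is the Chebyshev polynomial of the first kind ($T_m(\cos\theta)=\cos m\theta$). $F(a,b;c;z)=\sum_{k=0}^\infty \frac{(a)_k(b)_k}{(c)_k\,k!}z^k$, $|z|<1$, is the Gaussian hypergeometric function, with $(x)_k=x(x+1)\cdots(x+k-1)$, $(x)_0=1$. Superscript $3$ on a function denotes its cube. *)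

theory Defs
  imports "HOL-Analysis.Analysis"
begin

lemma cos_multiple_complex_poly_ex1:
  "\<exists>!p :: complex poly. \<forall>\<theta>::real. poly p (of_real (cos \<theta>)) = of_real (cos (real n * \<theta>))"
proof (rule ex_ex1I)
  have "(\<exists>p :: complex poly. \<forall>\<theta>::real. poly p (of_real (cos \<theta>)) = of_real (cos (real n * \<theta>))) \<and>
        (\<exists>p :: complex poly. \<forall>\<theta>::real. poly p (of_real (cos \<theta>)) = of_real (cos (real (Suc n) * \<theta>)))"
  proof (induction n)
    case 0
    show ?case
      by (intro conjI exI[of _ 1] exI[of _ "[:0, 1:]"]) auto
  next
    case (Suc n)
    then obtain p q :: "complex poly" where
      p: "\<And>\<theta>::real. poly p (of_real (cos \<theta>)) = of_real (cos (real n * \<theta>))" and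
      q: "\<And>\<theta>::real. poly q (of_real (cos \<theta>)) = of_real (cos (real (Suc n) * \<theta>))"
      by blast
    have "cos (real (Suc (Suc n)) * \<theta>) = 2 * cos \<theta> * cos (real (Suc n) * \<theta>) - cos (real n * \<theta>)"
      for \<theta> :: real
    proof -
      have "cos (real (Suc (Suc n)) * \<theta>) = cos (real (Suc n) * \<theta> + \<theta>)"
        by (simp add: algebra_simps)
      moreover have "cos (real n * \<theta>) = cos (real (Suc n) * \<theta> - \<theta>)"
        by (simp add: algebra_simps)
      ultimately show ?thesis
        by (simp only: cos_add cos_diff) (simp add: algebra_simps)
    qed
    then have "poly ([:0, 2:] * q - p) (of_real (cos \<theta>)) = of_real (cos (real (Suc (Suc n)) * \<theta>))"
      for \<theta> :: real
      by (simp only: poly_diff poly_mult p q) simp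
    then show ?case
      using q by blast
  qed
  then show "\<exists>p :: complex poly. \<forall>\<theta>::real. poly p (of_real (cos \<theta>)) = of_real (cos (real n * \<theta>))"
    by blast
next
  fix p q :: "complex poly"
  assume p: "\<forall>\<theta>::real. poly p (of_real (cos \<theta>)) = of_real (cos (real n * \<theta>))"
    and q: "\<forall>\<theta>::real. poly q (of_real (cos \<theta>)) = of_real (cos (real n * \<theta>))"
  have "of_real ` {-1..1::real} \<subseteq> {x. poly (p - q) x = 0}"
  proof safe
    fix x :: real
    assume "x \<in> {-1..1}"
    then have "x = cos (arccos x)"
      by simp
    then show "poly (p - q) (of_real x) = 0"
      using p q by (metis poly_diff right_minus_eq)
  qed
  moreover have "infinite (of_real ` {-1..1::real} :: complex set)"
    by (subst finite_image_iff) (auto simp: inj_on_def)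
  ultimately have "infinite {x. poly (p - q) x = 0}"
    using finite_subset by blast
  then show "p = q"
    using poly_roots_finite[of "p - q"] by auto
qed

definition chebyshev_T :: "nat \<Rightarrow> complex poly" where
  "chebyshev_T n =
     (THE p. \<forall>\<theta>::real. poly p (of_real (cos \<theta>)) = of_real (cos (real n * \<theta>)))"

lemma poly_chebyshev_T_cos:
  "poly (chebyshev_T n) (of_real (cos \<theta>)) = of_real (cos (real n * \<theta>))"
  using theI'[OF cos_multiple_complex_poly_ex1[of n]] unfolding chebyshev_T_def by blast

(* As suminf is total, this is meaningful only where the series converges, i.e. for norm z < 1
   (or if the series terminates), and if c is not a non-positive integer. *)
definition gauss_hypergeometric :: "complex \<Rightarrow> complex \<Rightarrow> complex \<Rightarrow> complex \<Rightarrow> complex" where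
  "gauss_hypergeometric a b c z =
     (\<Sum>k. pochhammer a k * pochhammer b k / (pochhammer c k * fact k) * z ^ k)"

end

theory Submission
  imports Defs
begin

text \<open>
  Two classical facts reduce the claim to algebra. First, the Gaussian series with parameters
  \<open>-x\<close>, \<open>x\<close>, \<open>1/2\<close> satisfies, as \<open>x\<close> moves in unit steps, the three-term recurrence of the
  Chebyshev polynomials at \<open>1 - 2 * z\<close>; comparing coefficients of powers of \<open>z\<close>, this is
  \<open>hypergeom_coeff_contiguous\<close>, and it identifies the series for \<open>x = m\<close> with \<open>T\<^sub>m (1 - 2 * z)\<close>
  (\<open>chebyshev_T_sums\<close>). Second, the triple angle formula \<open>4 * T\<^sub>m ^ 3 = T\<^sub>3\<^sub>m + 3 * T\<^sub>m\<close>
  (\<open>chebyshev_T_cube\<close>) linearises the cube, so that \<open>v\<close> is the combination with weights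
  \<open>1/4\<close> and \<open>3/4\<close> of the coefficient sequences for \<open>x = 3 * m\<close> and \<open>x = m\<close>.

  Each of these two sequences satisfies a first-order recurrence that depends on \<open>x\<close> through
  \<open>x\<^sup>2\<close> only. The recurrence for \<open>v\<close> is a common consequence of these two, for \<open>x\<^sup>2 = m\<^sup>2\<close> and
  \<open>x\<^sup>2 = 9 * m\<^sup>2\<close> (\<open>third_order_of_first_order\<close>). Being linear, it passes to \<open>v\<close>.
\<close>

section \<open>Coefficients of the hypergeometric series\<close>

definition hypergeom_coeff :: "complex \<Rightarrow> nat \<Rightarrow> complex" where
  "hypergeom_coeff x k =
     pochhammer (- x) k * pochhammer x k / (pochhammer (1 / 2) k * fact k)"

lemma pochhammer_half_neq_0: "pochhammer (1 / 2 :: complex) k \<noteq> 0"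
proof
  assume "pochhammer (1 / 2 :: complex) k = 0"
  then obtain j where "1 / 2 = - (of_nat j :: complex)"
    by (auto simp: pochhammer_eq_0_iff)
  then have "Re (1 / 2) = Re (- of_nat j)"
    by (simp only:)
  then show False
    by simp
qed

lemma hypergeom_coeff_0 [simp]: "hypergeom_coeff x 0 = 1"
  by (simp add: hypergeom_coeff_def)

lemma hypergeom_coeff_rec:
  "(of_nat k + 1) * (2 * of_nat k + 1) * hypergeom_coeff x (Suc k)
     = 2 * (of_nat k ^ 2 - x ^ 2) * hypergeom_coeff x k"
proof -
  have "2 * of_nat k + 1 \<noteq> (0 :: complex)" "of_nat k + 1 \<noteq> (0 :: complex)"
    using of_nat_eq_0_iff[where 'a = complex, of "2 * k + 1"]
      of_nat_eq_0_iff[where 'a = complex, of "k + 1"] by (simp_all add: add.commute)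
  moreover have "1 / 2 + of_nat k = (2 * of_nat k + 1) / (2 :: complex)"
    by (simp add: field_simps)
  ultimately show ?thesis
    using pochhammer_half_neq_0[of k]
    by (simp add: hypergeom_coeff_def pochhammer_Suc power2_eq_square divide_simps)
       (simp add: algebra_simps)
qed

text \<open>
  The three-term recurrence \<open>T\<^sub>m\<^sub>+\<^sub>1 + T\<^sub>m\<^sub>-\<^sub>1 = 2 * (1 - 2 * z) * T\<^sub>m\<close>, read off at the power
  \<open>z ^ (k + 1)\<close>. For \<open>k \<ge> 1\<close>, all four numerators share the factor
  \<open>pochhammer (1 - x) (k - 1) * pochhammer (1 + x) (k - 1)\<close>; what remains is a polynomial
  identity in \<open>x\<close> and \<open>k\<close>.
\<close>

lemma hypergeom_coeff_contiguous:
  "hypergeom_coeff (x + 1) (Suc k) + hypergeom_coeff (x - 1) (Suc k)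
     = 2 * hypergeom_coeff x (Suc k) - 4 * hypergeom_coeff x k"
proof (cases k)
  case 0
  then show ?thesis
    by (simp add: hypergeom_coeff_def algebra_simps)
next
  case (Suc j)
  define N :: complex where "N = of_nat j"
  define P where "P = pochhammer (1 + x) j"
  define Q where "Q = pochhammer (1 - x) j"
  define D where "D = pochhammer (1 / 2 :: complex) k * fact k"
  have D: "D \<noteq> 0"
    by (simp add: D_def pochhammer_half_neq_0)
  have N: "2 * N + 3 \<noteq> 0" "N + 2 \<noteq> 0"
  proof -
    have "2 * N + 3 = of_nat (2 * j + 3)" "N + 2 = of_nat (j + 2)"
      by (simp_all add: N_def)
    then show "2 * N + 3 \<noteq> 0" "N + 2 \<noteq> 0"
      by (simp_all only: of_nat_eq_0_iff)
  qed
  have den: "pochhammer (1 / 2 :: complex) (Suc k) * fact (Suc k) = D * ((2 * N + 3) * (N + 2) / 2)"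
    by (simp add: D_def N_def Suc pochhammer_Suc field_simps)
  have up: "pochhammer (y + 1) (Suc k) = pochhammer (1 + y) j * (1 + y + N) * (2 + y + N)" for y
    by (simp add: Suc pochhammer_Suc N_def algebra_simps)
  have mid: "pochhammer y (Suc k) = y * pochhammer (1 + y) j * (1 + y + N)" for y
    unfolding Suc pochhammer_rec[of y "Suc j"]
    by (simp add: pochhammer_Suc N_def algebra_simps)
  have down: "pochhammer (y - 1) (Suc k) = (y - 1) * y * pochhammer (1 + y) j" for y :: complex
    by (simp add: Suc pochhammer_rec mult.assoc add.commute)
  \<comment> \<open>\<open>K / 2\<close> is the new factor of the denominator at \<open>Suc k\<close>; \<open>E\<close> is the common part.\<close>
  define K where "K = (2 * N + 3) * (N + 2)"
  define E where "E = x * P * Q / (D * (K / 2))"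
  have K: "K \<noteq> 0"
    using N by (simp add: K_def)
  have neg: "- (x + 1) = - x - 1" "- (x - 1) = - x + 1"
    by simp_all
  have c1: "hypergeom_coeff (x + 1) (Suc k) = E * ((x + 1) * (1 + x + N) * (2 + x + N))"
  proof -
    have "pochhammer (- (x + 1)) (Suc k) * pochhammer (x + 1) (Suc k)
            = x * P * Q * ((x + 1) * (1 + x + N) * (2 + x + N))"
      unfolding neg(1) up[of x] down[of "- x"] by (simp add: P_def Q_def algebra_simps)
    then show ?thesis
      unfolding hypergeom_coeff_def den E_def K_def by simp
  qed
  have c2: "hypergeom_coeff (x - 1) (Suc k) = E * ((x - 1) * (1 - x + N) * (2 - x + N))"
  proof -
    have "pochhammer (- (x - 1)) (Suc k) * pochhammer (x - 1) (Suc k)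
            = x * P * Q * ((x - 1) * (1 - x + N) * (2 - x + N))"
      unfolding neg(2) up[of "- x"] down[of x] by (simp add: P_def Q_def algebra_simps)
    then show ?thesis
      unfolding hypergeom_coeff_def den E_def K_def by simp
  qed
  have c3: "hypergeom_coeff x (Suc k) = E * (- x * (1 - x + N) * (1 + x + N))"
  proof -
    have "pochhammer (- x) (Suc k) * pochhammer x (Suc k)
            = x * P * Q * (- x * (1 - x + N) * (1 + x + N))"
      unfolding mid by (simp add: P_def Q_def algebra_simps)
    then show ?thesis
      unfolding hypergeom_coeff_def den E_def K_def by simp
  qed
  have c4: "hypergeom_coeff x k = E * (- x * K / 2)"
  proof -
    have "hypergeom_coeff x k = (- x * Q) * (x * P) / D"
      by (simp add: hypergeom_coeff_def D_def P_def Q_def Suc pochhammer_rec add.commute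
          del: fact_Suc)
    then show ?thesis
      using D K by (simp add: E_def)
  qed
  have "(x + 1) * (1 + x + N) * (2 + x + N) + (x - 1) * (1 - x + N) * (2 - x + N)
          = 2 * (- x * (1 - x + N) * (1 + x + N)) - 4 * (- x * K / 2)"
    by (simp add: K_def) algebra
  then show ?thesis
    unfolding c1 c2 c3 c4 by (metis distrib_left right_diff_distrib mult.left_commute)
qed

section \<open>Chebyshev polynomials as hypergeometric series\<close>

lemma chebyshev_T_eqI:
  assumes "\<And>\<theta>::real. poly p (of_real (cos \<theta>)) = of_real (cos (real n * \<theta>))"
  shows "chebyshev_T n = p"
  using assms poly_chebyshev_T_cos cos_multiple_complex_poly_ex1[of n] by blast

lemma chebyshev_T_0: "chebyshev_T 0 = 1"
  by (rule chebyshev_T_eqI) simp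

lemma chebyshev_T_1: "chebyshev_T (Suc 0) = [:0, 1:]"
  by (rule chebyshev_T_eqI) simp

lemma chebyshev_T_rec:
  "chebyshev_T (Suc (Suc n)) = [:0, 2:] * chebyshev_T (Suc n) - chebyshev_T n"
proof (rule chebyshev_T_eqI)
  fix \<theta> :: real
  have "cos (real (Suc n) * \<theta> + \<theta>) + cos (real (Suc n) * \<theta> - \<theta>)
          = 2 * cos \<theta> * cos (real (Suc n) * \<theta>)"
    by (simp only: cos_add cos_diff) (simp add: algebra_simps)
  then have "cos (real (Suc (Suc n)) * \<theta>) = 2 * cos \<theta> * cos (real (Suc n) * \<theta>) - cos (real n * \<theta>)"
    by (simp add: algebra_simps)
  then show "poly ([:0, 2:] * chebyshev_T (Suc n) - chebyshev_T n) (of_real (cos \<theta>))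
               = of_real (cos (real (Suc (Suc n)) * \<theta>))"
    by (simp only: poly_diff poly_mult poly_chebyshev_T_cos) simp
qed

lemma chebyshev_T_cube: "chebyshev_T (3 * m) = 4 * chebyshev_T m ^ 3 - 3 * chebyshev_T m"
proof (rule chebyshev_T_eqI)
  fix \<theta> :: real
  have "cos (real (3 * m) * \<theta>) = 4 * cos (real m * \<theta>) ^ 3 - 3 * cos (real m * \<theta>)"
    using cos_treble_cos[of "real m * \<theta>"] by (simp add: mult.assoc)
  then show "poly (4 * chebyshev_T m ^ 3 - 3 * chebyshev_T m) (of_real (cos \<theta>))
               = of_real (cos (real (3 * m) * \<theta>))"
    by (simp only: poly_diff poly_mult poly_power poly_numeral poly_chebyshev_T_cos) simp
qed

text \<open>
  Both sides obey the same three-term recurrence in \<open>m\<close>, so the identity follows by induction from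
  the first two cases, where the series terminates.
\<close>

lemma chebyshev_T_sums:
  "(\<lambda>k. hypergeom_coeff (of_nat m) k * z ^ k) sums poly (chebyshev_T m) (1 - 2 * z)"
proof (induction m rule: induct_nat_012)
  case 0
  have "(\<lambda>k. hypergeom_coeff 0 k * z ^ k) sums (\<Sum>k\<in>{0}. hypergeom_coeff 0 k * z ^ k)"
    by (rule sums_finite) (auto simp: hypergeom_coeff_def pochhammer_0_left)
  then show ?case
    by (simp add: chebyshev_T_0)
next
  case 1
  have "hypergeom_coeff 1 k = 0" if "k \<notin> {0, 1}" for k
  proof -
    from that obtain j where "k = Suc (Suc j)"
      by (metis insertCI One_nat_def not0_implies_Suc)
    then show ?thesis
      by (simp add: hypergeom_coeff_def pochhammer_rec)
  qed
  then have "(\<lambda>k. hypergeom_coeff 1 k * z ^ k) sums (\<Sum>k\<in>{0, 1}. hypergeom_coeff 1 k * z ^ k)"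
    by (intro sums_finite) auto
  then show ?case
    by (simp add: chebyshev_T_1 hypergeom_coeff_def mult.commute)
next
  case (ge2 m)
  let ?c = "\<lambda>i k. hypergeom_coeff (of_nat i) k * z ^ k"
  let ?T = "\<lambda>i. poly (chebyshev_T i) (1 - 2 * z)"
  \<comment> \<open>The contiguous relation shifts the index, so the constant terms, all \<open>1\<close>, are split off.\<close>
  have tail: "(\<lambda>k. ?c i (Suc k)) sums (?T i - 1)" if "?c i sums ?T i" for i
    using that by (subst sums_Suc_iff) simp
  have "(\<lambda>k. 2 * ?c (Suc m) (Suc k) - ?c m (Suc k) - 4 * z * ?c (Suc m) k)
          sums (2 * (?T (Suc m) - 1) - (?T m - 1) - 4 * z * ?T (Suc m))"
    by (intro sums_diff sums_mult tail ge2)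
  also have "(\<lambda>k. 2 * ?c (Suc m) (Suc k) - ?c m (Suc k) - 4 * z * ?c (Suc m) k)
               = (\<lambda>k. ?c (Suc (Suc m)) (Suc k))"
  proof
    fix k
    have "hypergeom_coeff (of_nat (Suc (Suc m))) (Suc k) =
            2 * hypergeom_coeff (of_nat (Suc m)) (Suc k) - 4 * hypergeom_coeff (of_nat (Suc m)) k
              - hypergeom_coeff (of_nat m) (Suc k)"
      using hypergeom_coeff_contiguous[of "of_nat (Suc m)" k] by (simp add: algebra_simps)
    then show "2 * ?c (Suc m) (Suc k) - ?c m (Suc k) - 4 * z * ?c (Suc m) k
                 = ?c (Suc (Suc m)) (Suc k)"
      by (simp only:) (simp add: algebra_simps)
  qed
  finally have "?c (Suc (Suc m)) sums
      (2 * (?T (Suc m) - 1) - (?T m - 1) - 4 * z * ?T (Suc m) + ?c (Suc (Suc m)) 0)"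
    by (rule sums_Suc)
  also have "2 * (?T (Suc m) - 1) - (?T m - 1) - 4 * z * ?T (Suc m) + ?c (Suc (Suc m)) 0
               = ?T (Suc (Suc m))"
    by (simp add: chebyshev_T_rec algebra_simps)
  finally show ?case .
qed

lemma gauss_hypergeometric_eq_chebyshev_T:
  "gauss_hypergeometric (- of_nat m) (of_nat m) (1 / 2) z = poly (chebyshev_T m) (1 - 2 * z)"
  using sums_unique[OF chebyshev_T_sums[of m z]]
  by (simp add: gauss_hypergeometric_def hypergeom_coeff_def)

section \<open>The third-order recurrence\<close>

text \<open>
  Extending the coefficients by \<open>0\<close> to negative indices keeps the first-order recurrence valid at
  index \<open>-1\<close>, where both sides vanish. The recurrence for \<open>v\<close> at \<open>n = 1\<close>,
  which reaches back to \<open>v (-1)\<close>, is then no special case.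
\<close>

definition hypergeom_coeff_int :: "complex \<Rightarrow> int \<Rightarrow> complex" where
  "hypergeom_coeff_int x k = (if k < 0 then 0 else hypergeom_coeff x (nat k))"

lemma hypergeom_coeff_int_rec:
  assumes "k \<ge> -1"
  shows "(of_int k + 1) * (2 * of_int k + 1) * hypergeom_coeff_int x (k + 1)
           = 2 * (of_int k ^ 2 - x ^ 2) * hypergeom_coeff_int x k"
proof (cases "k = -1")
  case True
  then show ?thesis
    by (simp add: hypergeom_coeff_int_def)
next
  case False
  with assms have "k \<ge> 0"
    by simp
  then obtain j where "k = int j"
    by (rule nonneg_int_cases)
  then show ?thesis
    using hypergeom_coeff_rec[of j x]
    by (simp add: hypergeom_coeff_int_def nat_add_distrib)
qed

text \<open>
  The last coefficient of the third-order recurrence is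
  \<open>4 * ((n - 2)\<^sup>2 - M\<^sup>2) * ((n - 2)\<^sup>2 - 9 * M\<^sup>2)\<close>. As \<open>A\<close> is one of \<open>M\<^sup>2\<close>, \<open>9 * M\<^sup>2\<close>, one factor
  is \<open>(n - 2)\<^sup>2 - A\<close>, so the first-order recurrence turns the last term into a multiple of \<open>a1\<close>; in the same way, the terms in \<open>a2\<close> and
  \<open>a3\<close> become multiples of \<open>a1\<close>. What is left is a polynomial identity modulo the quadratic
  equation for \<open>A\<close>.
\<close>

lemma third_order_of_first_order:
  fixes n M A a0 a1 a2 a3 :: complex
  assumes A: "(A - M ^ 2) * (A - 9 * M ^ 2) = 0"
    and nz: "n \<noteq> 0" "n + 1 \<noteq> 0" "2 * n - 1 \<noteq> 0" "2 * n + 1 \<noteq> 0"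
    and a1: "(n - 1) * (2 * n - 3) * a1 = 2 * ((n - 2) ^ 2 - A) * a0"
    and a2: "n * (2 * n - 1) * a2 = 2 * ((n - 1) ^ 2 - A) * a1"
    and a3: "(n + 1) * (2 * n + 1) * a3 = 2 * (n ^ 2 - A) * a2"
  shows "a3 =
      (- 20 * M ^ 2 + 6 * n ^ 2 - 9 * n + 5) / (2 * n ^ 2 + 3 * n + 1) * a2
    + (- 36 * M ^ 4 + 20 * M ^ 2 * (n - 1) * (4 * n - 5)
         - 2 * (n - 1) * (2 * n * (3 * (n - 4) * n + 17) - 17))
        / (n * (n + 1) * (2 * n - 1) * (2 * n + 1)) * a1
    + 4 * (9 * M ^ 4 - 10 * M ^ 2 * (n - 2) ^ 2 + (n - 2) ^ 4)
        / (n * (n + 1) * (2 * n - 1) * (2 * n + 1)) * a0"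
    (is "a3 = ?p / _ * a2 + ?q / ?D * a1 + 4 * ?r / ?D * a0")
proof -
  have D: "?D \<noteq> 0"
    using nz by simp
  \<comment> \<open>\<open>10 * M\<^sup>2 - A\<close> is the other root of the quadratic equation for \<open>A\<close>.\<close>
  have "?r = ((n - 2) ^ 2 - (10 * M ^ 2 - A)) * ((n - 2) ^ 2 - A)"
    using A by algebra
  then have r: "4 * ?r * a0 = 2 * ((n - 2) ^ 2 - (10 * M ^ 2 - A)) * ((n - 1) * (2 * n - 3) * a1)"
    unfolding a1 by algebra
  have "?D * a3 = n * (2 * n - 1) * (2 * (n ^ 2 - A) * a2)"
    unfolding a3[symmetric] by (simp add: algebra_simps)
  also have "\<dots> = 2 * (n ^ 2 - A) * (n * (2 * n - 1) * a2)"
    by (simp add: algebra_simps)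
  also have "\<dots> = 2 * (n ^ 2 - A) * (2 * ((n - 1) ^ 2 - A) * a1)"
    unfolding a2 ..
  also have "\<dots> = ?p * (2 * ((n - 1) ^ 2 - A) * a1) + ?q * a1
      + 2 * ((n - 2) ^ 2 - (10 * M ^ 2 - A)) * ((n - 1) * (2 * n - 3) * a1)"
    using A by algebra
  also have "\<dots> = ?p * (n * (2 * n - 1) * a2) + ?q * a1 + 4 * ?r * a0"
    unfolding a2 r ..
  finally have *: "a3 = (?p * (n * (2 * n - 1) * a2) + ?q * a1 + 4 * ?r * a0) / ?D"
    using D by (simp only: eq_divide_eq mult.commute) simp
  have "2 * n ^ 2 + 3 * n + 1 = (n + 1) * (2 * n + 1)"
    by algebra
  moreover have "?p * (n * (2 * n - 1) * a2) / ?D = ?p / ((n + 1) * (2 * n + 1)) * a2"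
    using nz by (simp add: divide_simps)
  ultimately show ?thesis
    unfolding * add_divide_distrib by simp
qed

lemma hypergeom_coeff_int_third_order:
  fixes x M :: complex and i :: int
  defines "n \<equiv> of_int i :: complex"
  assumes i: "i \<ge> 1" and x: "x = M \<or> x = 3 * M"
  shows "hypergeom_coeff_int x (i + 1) =
      (- 20 * M ^ 2 + 6 * n ^ 2 - 9 * n + 5) / (2 * n ^ 2 + 3 * n + 1) * hypergeom_coeff_int x i
    + (- 36 * M ^ 4 + 20 * M ^ 2 * (n - 1) * (4 * n - 5)
         - 2 * (n - 1) * (2 * n * (3 * (n - 4) * n + 17) - 17))
        / (n * (n + 1) * (2 * n - 1) * (2 * n + 1)) * hypergeom_coeff_int x (i - 1)
    + 4 * (9 * M ^ 4 - 10 * M ^ 2 * (n - 2) ^ 2 + (n - 2) ^ 4)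
        / (n * (n + 1) * (2 * n - 1) * (2 * n + 1)) * hypergeom_coeff_int x (i - 2)"
proof (rule third_order_of_first_order[where A = "x ^ 2"])
  show "(x ^ 2 - M ^ 2) * (x ^ 2 - 9 * M ^ 2) = 0"
    using x by (auto simp: power_mult_distrib)
  have "n = of_int i" "n + 1 = of_int (i + 1)" "2 * n - 1 = of_int (2 * i - 1)"
    "2 * n + 1 = of_int (2 * i + 1)"
    by (simp_all add: n_def)
  then show "n \<noteq> 0" "n + 1 \<noteq> 0" "2 * n - 1 \<noteq> 0" "2 * n + 1 \<noteq> 0"
    using i by (simp_all only: of_int_eq_0_iff)
  show "(n - 1) * (2 * n - 3) * hypergeom_coeff_int x (i - 1)
          = 2 * ((n - 2) ^ 2 - x ^ 2) * hypergeom_coeff_int x (i - 2)"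
    using hypergeom_coeff_int_rec[of "i - 2" x] i by (simp add: n_def)
  show "n * (2 * n - 1) * hypergeom_coeff_int x i
          = 2 * ((n - 1) ^ 2 - x ^ 2) * hypergeom_coeff_int x (i - 1)"
    using hypergeom_coeff_int_rec[of "i - 1" x] i by (simp add: n_def)
  show "(n + 1) * (2 * n + 1) * hypergeom_coeff_int x (i + 1)
          = 2 * (n ^ 2 - x ^ 2) * hypergeom_coeff_int x i"
    using hypergeom_coeff_int_rec[of i x] i by (simp add: n_def)
qed

theorem corollary3p3:
  fixes m :: nat
  shows "\<exists>v :: int \<Rightarrow> complex.
    v (-1) = 0 \<and>
    v 0 = 1 \<and>
    v 1 = - 6 * of_nat m ^ 2 \<and>
    v 2 = 2 * (7 * of_nat m ^ 4 - of_nat m ^ 2) \<and>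
    (\<forall>i::int. i \<ge> 1 \<longrightarrow>
      (let M = of_nat m :: complex; n = of_int i :: complex in
        v (i + 1) =
          (- 20 * M ^ 2 + 6 * n ^ 2 - 9 * n + 5) / (2 * n ^ 2 + 3 * n + 1) * v i
        + (- 36 * M ^ 4 + 20 * M ^ 2 * (n - 1) * (4 * n - 5)
             - 2 * (n - 1) * (2 * n * (3 * (n - 4) * n + 17) - 17))
            / (n * (n + 1) * (2 * n - 1) * (2 * n + 1)) * v (i - 1)
        + 4 * (9 * M ^ 4 - 10 * M ^ 2 * (n - 2) ^ 2 + (n - 2) ^ 4)
            / (n * (n + 1) * (2 * n - 1) * (2 * n + 1)) * v (i - 2))) \<and>
    (\<forall>z::complex. norm z < 1 \<longrightarrow>
      poly (chebyshev_T m) (1 - 2 * z) ^ 3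
        = gauss_hypergeometric (- of_nat m) (of_nat m) (1 / 2) z ^ 3 \<and>
      (\<lambda>k::nat. v (int k) * z ^ k) sums
        gauss_hypergeometric (- of_nat m) (of_nat m) (1 / 2) z ^ 3)"
proof -
  define M :: complex where "M = of_nat m"
  \<comment> \<open>The weights come from \<open>T\<^sub>m ^ 3 = (T\<^sub>3\<^sub>m + 3 * T\<^sub>m) / 4\<close>.\<close>
  define v where
    "v i = (hypergeom_coeff_int (3 * M) i + 3 * hypergeom_coeff_int M i) / 4" for i
  have h1: "hypergeom_coeff_int x 1 = - 2 * x ^ 2" for x
    by (simp add: hypergeom_coeff_int_def hypergeom_coeff_def power2_eq_square)
  have h2: "hypergeom_coeff_int x 2 = 4 * (x ^ 4 - x ^ 2) / 6" for x
  proof -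
    have "6 * hypergeom_coeff_int x 2 = 4 * (x ^ 4 - x ^ 2)"
      using hypergeom_coeff_int_rec[of 1 x]
      by (simp add: h1 algebra_simps power4_eq_xxxx power2_eq_square)
    then show ?thesis
      by (simp add: eq_divide_eq mult.commute del: eq_divide_eq_numeral1)
  qed
  have rec: "v (i + 1) =
          (- 20 * M ^ 2 + 6 * n ^ 2 - 9 * n + 5) / (2 * n ^ 2 + 3 * n + 1) * v i
        + (- 36 * M ^ 4 + 20 * M ^ 2 * (n - 1) * (4 * n - 5)
             - 2 * (n - 1) * (2 * n * (3 * (n - 4) * n + 17) - 17))
            / (n * (n + 1) * (2 * n - 1) * (2 * n + 1)) * v (i - 1)
        + 4 * (9 * M ^ 4 - 10 * M ^ 2 * (n - 2) ^ 2 + (n - 2) ^ 4)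
            / (n * (n + 1) * (2 * n - 1) * (2 * n + 1)) * v (i - 2)"
    if "i \<ge> 1" "n = of_int i" for i n
  proof -
    have "(p * a2 + q * a1 + r * a0 + 3 * (p * b2 + q * b1 + r * b0)) / 4
        = p * ((a2 + 3 * b2) / 4) + q * ((a1 + 3 * b1) / 4) + r * ((a0 + 3 * b0) / 4)"
      for p q r a0 a1 a2 b0 b1 b2 :: complex
      by (simp add: field_simps)
    then show ?thesis
      unfolding v_def that(2)
        hypergeom_coeff_int_third_order[where M = M, OF that(1) disjI2[OF refl]]
        hypergeom_coeff_int_third_order[where M = M, OF that(1) disjI1[OF refl]] .
  qed
  have series: "(\<lambda>k. v (int k) * z ^ k) sums poly (chebyshev_T m) (1 - 2 * z) ^ 3" for z
  proof -
    have "(\<lambda>k. (hypergeom_coeff (of_nat (3 * m)) k * z ^ k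
                 + 3 * (hypergeom_coeff (of_nat m) k * z ^ k)) / 4)
            sums ((poly (chebyshev_T (3 * m)) (1 - 2 * z)
                    + 3 * poly (chebyshev_T m) (1 - 2 * z)) / 4)"
      by (intro sums_divide sums_add sums_mult chebyshev_T_sums)
    also have "(poly (chebyshev_T (3 * m)) (1 - 2 * z) + 3 * poly (chebyshev_T m) (1 - 2 * z)) / 4
        = poly (chebyshev_T m) (1 - 2 * z) ^ 3"
      by (simp add: chebyshev_T_cube)
    finally show ?thesis
      by (simp add: v_def M_def hypergeom_coeff_int_def algebra_simps)
  qed
  have "v (-1) = 0" "v 0 = 1"
    by (simp_all add: v_def hypergeom_coeff_int_def)
  moreover have "v 1 = - 6 * of_nat m ^ 2" "v 2 = 2 * (7 * of_nat m ^ 4 - of_nat m ^ 2)"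
    by (simp_all add: v_def h1 h2 M_def power_mult_distrib field_simps)
  ultimately show ?thesis
    unfolding Let_def gauss_hypergeometric_eq_chebyshev_T
    using rec[unfolded M_def] series by (intro exI[of _ v] conjI allI impI) simp_all
qed

end
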